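(* Let $J\in\{I,J_1,J_+\}$, let $X$ and $Y$ be closure spaces and let $f,g:X\to Y$ be continuous maps with $f\sim_{(J,\times)}g$. Then $f_*=g_*:H^J_n(X)\to H^J_n(Y)$ for all $n\ge 0$.
   Context: A closure space $(X,c)$ is a set $X$ with a map $c:\mathcal P(X)\to\mathcal P(X)$ such that $c(\emptyset)=\emptyset$, $A\subseteq c(A)$, and $c(A\cup B)=c(A)\cup c(B)$. The interior is $i(A)=X\setminus c(X\setminus A)$, and $V$ is a neighborhood of $x$ if $x\in i(V)$. A map $f:(X,c)\to(Y,d)$ is continuous if $f(c(A))\subseteq d(f(A))$ for all $A\subseteq X$. Topological spaces are closure spaces via the topological closure. The product $X\times Y$ is the set product with the closure for which the sets $U\times V$ ($U$ a neighborhood of $x$, $V$ of $y$) form a neighborhood base at $(x,y)$ (the categorical product). Spaces: $I=[0,1]$ with the usual topology; $J_1=\{0,1\}$ with the indiscrete closure; $J_+=\{0,1\}$ with $c(\{0\})=\{0,1\}$, $c(\{1\})=\{1\}$. Singular simplices: $|\Delta^n|^{I}$ is the standard topological $n$-simplex; $|\Delta^n|^{J_1}$ is $\{0,\dots,n\}$ with the indiscrete closure; $|\Delta^n|^{J_+}$ is $\{0,\dots,n\}$ with $c(\{i\})=\{j: j\ge i\}$. $C^J_n(X)$ is the free abelian group on continuous maps $\sigma:|\Delta^n|^J\to X$, with $\partial\sigma=\sum_{i=0}^n(-1)^i\sigma\circ d^i$, where $d^i:|\Delta^{n-1}|^J\to|\Delta^n|^J$ is the $i$-th face inclusion (induced by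 the order-preserving injection omitting $i$). $H^J_n(X)$ is the homology of $C^J_\bullet(X)$; a continuous $f$ induces $f_*$ via $\sigma\mapsto f\circ\sigma$. Homotopy: $f,g:X\to Y$ are one-step $(J,\times)$-homotopic if there is a continuous $H:X\times J\to Y$ with $H(x,0)=f(x)$ and $H(x,1)=g(x)$ for all $x$; $\sim_{(J,\times)}$ is the equivalence relation on continuous maps $X\to Y$ generated by one-step $(J,\times)$-homotopy. *)

theory Defs
  imports "HOL-Homology.Homology"
begin

section \<open>Closure spaces\<close>

record 'a cspace =
  pts :: "'a set"
  cl :: "'a set \<Rightarrow> 'a set"

text \<open>The values of \<open>cl X\<close> outside the power set of \<open>pts X\<close> are irrelevant; no definition below looks at
  them.\<close>

definition closure_space :: "'a cspace \<Rightarrow> bool" where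
  "closure_space X \<longleftrightarrow>
     cl X {} = {} \<and>
     (\<forall>A. A \<subseteq> pts X \<longrightarrow> A \<subseteq> cl X A \<and> cl X A \<subseteq> pts X) \<and>
     (\<forall>A B. A \<subseteq> pts X \<longrightarrow> B \<subseteq> pts X \<longrightarrow> cl X (A \<union> B) = cl X A \<union> cl X B)"

definition cs_interior :: "'a cspace \<Rightarrow> 'a set \<Rightarrow> 'a set" where
  "cs_interior X A = pts X - cl X (pts X - A)"

definition cs_nbhd :: "'a cspace \<Rightarrow> 'a \<Rightarrow> 'a set \<Rightarrow> bool" where
  "cs_nbhd X x V \<longleftrightarrow> V \<subseteq> pts X \<and> x \<in> cs_interior X V"

definition cs_continuous :: "'a cspace \<Rightarrow> 'b cspace \<Rightarrow> ('a \<Rightarrow> 'b) \<Rightarrow> bool" where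
  "cs_continuous X Y f \<longleftrightarrow>
     f \<in> pts X \<rightarrow> pts Y \<and> (\<forall>A. A \<subseteq> pts X \<longrightarrow> f ` cl X A \<subseteq> cl Y (f ` A))"

definition cs_of_topology :: "'a topology \<Rightarrow> 'a cspace" where
  "cs_of_topology T = \<lparr>pts = topspace T, cl = Abstract_Topology.closure_of T\<rparr>"

definition cs_indiscrete :: "'a set \<Rightarrow> 'a cspace" where
  "cs_indiscrete S = \<lparr>pts = S, cl = (\<lambda>A. if A = {} then {} else S)\<rparr>"

text \<open>The additive closure on \<open>S\<close> determined by the closures \<open>N i\<close> of the singletons \<open>{i}\<close>; on a finite
  set every closure operation is of this form.\<close>

definition cs_of_singletons :: "'a set \<Rightarrow> ('a \<Rightarrow> 'a set) \<Rightarrow> 'a cspace" where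
  "cs_of_singletons S N = \<lparr>pts = S, cl = (\<lambda>A. \<Union>i\<in>A. N i)\<rparr>"

text \<open>In a closure space, \<open>p\<close> lies in the closure of \<open>A\<close> iff every member of a neighbourhood base at \<open>p\<close>
  meets \<open>A\<close>. This dictates the closure operation of the product; \<open>cs_nbhd_cs_prod\<close> and
  \<open>cs_prod_unique\<close> below confirm that it is the one whose neighbourhoods have the boxes as base.\<close>

definition cs_prod :: "'a cspace \<Rightarrow> 'b cspace \<Rightarrow> ('a \<times> 'b) cspace" where
  "cs_prod X Y =
     \<lparr>pts = pts X \<times> pts Y,
      cl = (\<lambda>A. {(x, y). x \<in> pts X \<and> y \<in> pts Y \<and>
                  (\<forall>U V. cs_nbhd X x U \<longrightarrow> cs_nbhd Y y V \<longrightarrow> (U \<times> V) \<inter> A \<noteq> {})})\<rparr>"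

lemma closure_space_mono:
  assumes "closure_space X" "A \<subseteq> B" "B \<subseteq> pts X"
  shows "cl X A \<subseteq> cl X B"
proof -
  have "cl X (A \<union> B) = cl X A \<union> cl X B"
    using assms unfolding closure_space_def by (meson subset_trans)
  then show ?thesis using assms(2) by (metis Un_upper1 sup.absorb2)
qed

lemma cs_nbhd_mem:
  assumes "closure_space X" "cs_nbhd X x V"
  shows "x \<in> V"
  using assms unfolding closure_space_def cs_nbhd_def cs_interior_def by blast

lemma cs_nbhd_mono:
  assumes "closure_space X" "cs_nbhd X x U" "U \<subseteq> V" "V \<subseteq> pts X"
  shows "cs_nbhd X x V"
proof -
  have "cl X (pts X - V) \<subseteq> cl X (pts X - U)"
    using assms by (intro closure_space_mono) auto
  then show ?thesis using assms unfolding cs_nbhd_def cs_interior_def by blast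
qed

lemma cs_nbhd_Int:
  assumes "closure_space X" "cs_nbhd X x U" "cs_nbhd X x V"
  shows "cs_nbhd X x (U \<inter> V)"
proof -
  have "cl X ((pts X - U) \<union> (pts X - V)) = cl X (pts X - U) \<union> cl X (pts X - V)"
    using assms(1) unfolding closure_space_def by (meson Diff_subset)
  moreover have "pts X - U \<inter> V = (pts X - U) \<union> (pts X - V)" by blast
  ultimately show ?thesis using assms unfolding cs_nbhd_def cs_interior_def by auto
qed

lemma cs_nbhd_pts: "closure_space X \<Longrightarrow> x \<in> pts X \<Longrightarrow> cs_nbhd X x (pts X)"
  unfolding cs_nbhd_def cs_interior_def closure_space_def by simp

lemma in_cl_iff_cs_nbhd:
  assumes "closure_space X" "A \<subseteq> pts X"
  shows "x \<in> cl X A \<longleftrightarrow> x \<in> pts X \<and> (\<forall>V. cs_nbhd X x V \<longrightarrow> V \<inter> A \<noteq> {})"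
proof
  assume x: "x \<in> cl X A"
  have "V \<inter> A \<noteq> {}" if "cs_nbhd X x V" for V
  proof
    assume "V \<inter> A = {}"
    then have "cl X A \<subseteq> cl X (pts X - V)"
      using assms by (intro closure_space_mono) auto
    then show False using that x unfolding cs_nbhd_def cs_interior_def by blast
  qed
  then show "x \<in> pts X \<and> (\<forall>V. cs_nbhd X x V \<longrightarrow> V \<inter> A \<noteq> {})"
    using x assms unfolding closure_space_def by blast
next
  assume r: "x \<in> pts X \<and> (\<forall>V. cs_nbhd X x V \<longrightarrow> V \<inter> A \<noteq> {})"
  show "x \<in> cl X A"
  proof (rule ccontr)
    assume "x \<notin> cl X A"
    moreover have "pts X - (pts X - A) = A" using assms(2) by blast
    ultimately have "cs_nbhd X x (pts X - A)"
      using r unfolding cs_nbhd_def cs_interior_def by auto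
    then show False using r by blast
  qed
qed

lemma cs_nbhd_cs_prod:
  "cs_nbhd (cs_prod X Y) (x, y) W \<longleftrightarrow>
     x \<in> pts X \<and> y \<in> pts Y \<and> W \<subseteq> pts X \<times> pts Y \<and>
     (\<exists>U V. cs_nbhd X x U \<and> cs_nbhd Y y V \<and> U \<times> V \<subseteq> W)" (is "?L \<longleftrightarrow> ?R")
proof -
  have eq: "(U \<times> V) \<inter> (pts X \<times> pts Y - W) = {} \<longleftrightarrow> U \<times> V \<subseteq> W"
    if "cs_nbhd X x U" "cs_nbhd Y y V" for U V
    using that unfolding cs_nbhd_def by blast
  show ?thesis
    unfolding cs_nbhd_def[of "cs_prod X Y"] cs_interior_def[of "cs_prod X Y"]
    using eq by (auto simp: cs_prod_def)
qed

lemma in_cl_cs_prod: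
  "(x, y) \<in> cl (cs_prod X Y) A \<longleftrightarrow>
     x \<in> pts X \<and> y \<in> pts Y \<and>
     (\<forall>U V. cs_nbhd X x U \<longrightarrow> cs_nbhd Y y V \<longrightarrow> (U \<times> V) \<inter> A \<noteq> {})"
  by (simp add: cs_prod_def)

lemma closure_space_cs_prod:
  assumes X: "closure_space X" and Y: "closure_space Y"
  shows "closure_space (cs_prod X Y)"
  unfolding closure_space_def
proof (intro conjI allI impI)
  show "cl (cs_prod X Y) {} = {}"
    unfolding set_eq_iff split_paired_All in_cl_cs_prod
    using cs_nbhd_pts[OF X] cs_nbhd_pts[OF Y] by blast
next
  fix A assume A: "A \<subseteq> pts (cs_prod X Y)"
  show "A \<subseteq> cl (cs_prod X Y) A"
  proof (rule subrelI)
    fix x y assume xy: "(x, y) \<in> A"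
    have "(U \<times> V) \<inter> A \<noteq> {}" if "cs_nbhd X x U" "cs_nbhd Y y V" for U V
      using xy cs_nbhd_mem[OF X that(1)] cs_nbhd_mem[OF Y that(2)] by blast
    moreover have "x \<in> pts X \<and> y \<in> pts Y" using A xy by (auto simp: cs_prod_def)
    ultimately show "(x, y) \<in> cl (cs_prod X Y) A" by (simp add: in_cl_cs_prod)
  qed
  show "cl (cs_prod X Y) A \<subseteq> pts (cs_prod X Y)" by (auto simp: cs_prod_def)
next
  fix A B
  have mono: "cl (cs_prod X Y) C \<subseteq> cl (cs_prod X Y) D" if "C \<subseteq> D" for C D
  proof (rule subrelI)
    fix x y assume "(x, y) \<in> cl (cs_prod X Y) C"
    then show "(x, y) \<in> cl (cs_prod X Y) D"
      unfolding in_cl_cs_prod using Int_mono[OF order_refl that] by (metis subset_empty)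
  qed
  have "cl (cs_prod X Y) (A \<union> B) \<subseteq> cl (cs_prod X Y) A \<union> cl (cs_prod X Y) B"
  proof (rule subrelI, rule ccontr)
    fix x y
    assume p: "(x, y) \<in> cl (cs_prod X Y) (A \<union> B)"
      and "(x, y) \<notin> cl (cs_prod X Y) A \<union> cl (cs_prod X Y) B"
    then obtain U V U' V' where
      *: "cs_nbhd X x U" "cs_nbhd Y y V" "(U \<times> V) \<inter> A = {}"
         "cs_nbhd X x U'" "cs_nbhd Y y V'" "(U' \<times> V') \<inter> B = {}"
      unfolding Un_iff in_cl_cs_prod by metis
    have "((U \<inter> U') \<times> (V \<inter> V')) \<inter> (A \<union> B) \<noteq> {}"
      using p cs_nbhd_Int[OF X *(1,4)] cs_nbhd_Int[OF Y *(2,5)] unfolding in_cl_cs_prod by metis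
    then show False using *(3,6) by blast
  qed
  moreover have "cl (cs_prod X Y) A \<union> cl (cs_prod X Y) B \<subseteq> cl (cs_prod X Y) (A \<union> B)"
    using mono[of A "A \<union> B"] mono[of B "A \<union> B"] by simp
  ultimately show "cl (cs_prod X Y) (A \<union> B) = cl (cs_prod X Y) A \<union> cl (cs_prod X Y) B"
    by (rule subset_antisym)
qed

lemma cs_prod_unique:
  assumes X: "closure_space X" and Y: "closure_space Y"
    and Z: "closure_space Z" "pts Z = pts X \<times> pts Y"
    and nbhd: "\<And>x y W. \<lbrakk>x \<in> pts X; y \<in> pts Y; W \<subseteq> pts X \<times> pts Y\<rbrakk> \<Longrightarrow>
      cs_nbhd Z (x, y) W \<longleftrightarrow> (\<exists>U V. cs_nbhd X x U \<and> cs_nbhd Y y V \<and> U \<times> V \<subseteq> W)"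
    and A: "A \<subseteq> pts X \<times> pts Y"
  shows "cl Z A = cl (cs_prod X Y) A"
proof -
  have P: "closure_space (cs_prod X Y)" "pts (cs_prod X Y) = pts X \<times> pts Y"
    using closure_space_cs_prod[OF X Y] by (simp_all add: cs_prod_def)
  have "cs_nbhd Z p W \<longleftrightarrow> cs_nbhd (cs_prod X Y) p W" if "p \<in> pts X \<times> pts Y" for p W
  proof (cases "W \<subseteq> pts X \<times> pts Y")
    case True
    then show ?thesis using nbhd that by (cases p) (auto simp: cs_nbhd_cs_prod)
  next
    case False
    then show ?thesis using Z P by (simp add: cs_nbhd_def)
  qed
  then show ?thesis
    using in_cl_iff_cs_nbhd[OF Z(1), of A] in_cl_iff_cs_nbhd[OF P(1), of A] Z(2) P(2) A by auto
qed

lemma closure_space_cs_of_topology: "closure_space (cs_of_topology T)"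
  by (simp add: closure_space_def cs_of_topology_def closure_of_subset closure_of_subset_topspace)

lemma closure_space_cs_indiscrete: "closure_space (cs_indiscrete S)"
  by (auto simp: closure_space_def cs_indiscrete_def)

lemma closure_space_cs_of_singletons:
  assumes "\<And>i. i \<in> S \<Longrightarrow> i \<in> N i" "\<And>i. i \<in> S \<Longrightarrow> N i \<subseteq> S"
  shows "closure_space (cs_of_singletons S N)"
  unfolding closure_space_def cs_of_singletons_def using assms by (simp, blast)


section \<open>The intervals and the associated simplices\<close>

definition J_I :: "real cspace" where
  "J_I = cs_of_topology (top_of_set {0..1})"

definition J_one :: "nat cspace" where
  "J_one = cs_indiscrete {0, 1}"

definition J_plus :: "nat cspace" where
  "J_plus = cs_of_singletons {0, 1} (\<lambda>i. if i = 0 then {0, 1} else {1})"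

text \<open>\<open>csimp S n\<close> is the \<open>n\<close>-simplex and \<open>cface S i\<close> the \<open>i\<close>-th face inclusion \<open>d\<^sup>i\<close>. For each of the three
  families below a single function serves as \<open>d\<^sup>i\<close> from the (\<open>n - 1\<close>)-simplex to the
  \<open>n\<close>-simplex for all \<open>n\<close>.\<close>

record 'p simplices =
  csimp :: "nat \<Rightarrow> 'p cspace"
  cface :: "nat \<Rightarrow> 'p \<Rightarrow> 'p"

definition S_I :: "(nat \<Rightarrow> real) simplices" where
  "S_I = \<lparr>csimp = (\<lambda>n. cs_of_topology (subtopology (powertop_real UNIV) (standard_simplex n))),
          cface = simplical_face\<rparr>"

definition vertex_face :: "nat \<Rightarrow> nat \<Rightarrow> nat" where
  "vertex_face i j = (if j < i then j else Suc j)"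

definition S_one :: "nat simplices" where
  "S_one = \<lparr>csimp = (\<lambda>n. cs_indiscrete {0..n}), cface = vertex_face\<rparr>"

definition S_plus :: "nat simplices" where
  "S_plus = \<lparr>csimp = (\<lambda>n. cs_of_singletons {0..n} (\<lambda>i. {i..n})), cface = vertex_face\<rparr>"


section \<open>Singular homology\<close>

text \<open>As in HOL-Homology, a singular simplex is made extensional so that it is determined by its values
  on the simplex.\<close>

definition cs_simplices :: "'p simplices \<Rightarrow> nat \<Rightarrow> 'a cspace \<Rightarrow> ('p \<Rightarrow> 'a) set" where
  "cs_simplices S n X =
     {\<sigma>. cs_continuous (csimp S n) X \<sigma> \<and> \<sigma> \<in> extensional (pts (csimp S n))}"

definition cs_chain_group :: "'p simplices \<Rightarrow> nat \<Rightarrow> 'a cspace \<Rightarrow> (('p \<Rightarrow> 'a) \<Rightarrow>\<^sub>0 int) monoid" where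
  "cs_chain_group S n X = free_Abelian_group (cs_simplices S n X)"

definition cs_boundary :: "'p simplices \<Rightarrow> nat \<Rightarrow> (('p \<Rightarrow> 'a) \<Rightarrow>\<^sub>0 int) \<Rightarrow> (('p \<Rightarrow> 'a) \<Rightarrow>\<^sub>0 int)" where
  "cs_boundary S n c =
     (if n = 0 then 0
      else frag_extend
             (\<lambda>\<sigma>. \<Sum>i\<le>n. frag_cmul ((-1) ^ i)
                (frag_of (restrict (\<sigma> \<circ> cface S i) (pts (csimp S (n - 1)))))) c)"

definition cs_cycles :: "'p simplices \<Rightarrow> nat \<Rightarrow> 'a cspace \<Rightarrow> (('p \<Rightarrow> 'a) \<Rightarrow>\<^sub>0 int) set" where
  "cs_cycles S n X = {c \<in> carrier (cs_chain_group S n X). cs_boundary S n c = 0}"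

definition cs_boundaries :: "'p simplices \<Rightarrow> nat \<Rightarrow> 'a cspace \<Rightarrow> (('p \<Rightarrow> 'a) \<Rightarrow>\<^sub>0 int) set" where
  "cs_boundaries S n X = cs_boundary S (Suc n) ` carrier (cs_chain_group S (Suc n) X)"

definition cs_homology_group :: "'p simplices \<Rightarrow> nat \<Rightarrow> 'a cspace \<Rightarrow> (('p \<Rightarrow> 'a) \<Rightarrow>\<^sub>0 int) set monoid" where
  "cs_homology_group S n X =
     subgroup_generated (cs_chain_group S n X) (cs_cycles S n X) Mod cs_boundaries S n X"

definition cs_chain_map ::
  "'p simplices \<Rightarrow> nat \<Rightarrow> ('a \<Rightarrow> 'b) \<Rightarrow> (('p \<Rightarrow> 'a) \<Rightarrow>\<^sub>0 int) \<Rightarrow> (('p \<Rightarrow> 'b) \<Rightarrow>\<^sub>0 int)" where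
  "cs_chain_map S n f =
     frag_extend (\<lambda>\<sigma>. frag_of (restrict (f \<circ> \<sigma>) (pts (csimp S n))))"

text \<open>A homology class \<open>a\<close> is a coset of cycles. For continuous \<open>f\<close> the cosets in the union below all
  coincide, so the union is the class of the image of any representative of \<open>a\<close>.\<close>

definition cs_hom_induced ::
  "'p simplices \<Rightarrow> nat \<Rightarrow> 'a cspace \<Rightarrow> 'b cspace \<Rightarrow> ('a \<Rightarrow> 'b) \<Rightarrow>
     (('p \<Rightarrow> 'a) \<Rightarrow>\<^sub>0 int) set \<Rightarrow> (('p \<Rightarrow> 'b) \<Rightarrow>\<^sub>0 int) set" where
  "cs_hom_induced S n X Y f =
     (\<lambda>a \<in> carrier (cs_homology_group S n X).
        \<Union>c\<in>a. cs_boundaries S n Y #>\<^bsub>cs_chain_group S n Y\<^esub> cs_chain_map S n f c)"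


section \<open>Homotopy\<close>

definition one_step_homotopic ::
  "'j::zero_neq_one cspace \<Rightarrow> 'a cspace \<Rightarrow> 'b cspace \<Rightarrow> ('a \<Rightarrow> 'b) \<Rightarrow> ('a \<Rightarrow> 'b) \<Rightarrow> bool" where
  "one_step_homotopic J X Y f g \<longleftrightarrow>
     cs_continuous X Y f \<and> cs_continuous X Y g \<and>
     (\<exists>H. cs_continuous (cs_prod X J) Y H \<and>
          (\<forall>x \<in> pts X. H (x, 0) = f x \<and> H (x, 1) = g x))"

definition cs_homotopic ::
  "'j::zero_neq_one cspace \<Rightarrow> 'a cspace \<Rightarrow> 'b cspace \<Rightarrow> ('a \<Rightarrow> 'b) \<Rightarrow> ('a \<Rightarrow> 'b) \<Rightarrow> bool" where
  "cs_homotopic J X Y = equivclp (one_step_homotopic J X Y)"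

end

theory Submission
  imports Defs
begin

text \<open>As for topological spaces, a one-step homotopy \<open>H\<close> yields a prism operator \<open>P\<close> with
  \<open>\<partial>P + P\<partial> = g\<^sub># - f\<^sub>#\<close>. The prism is parametrised by the simplices themselves:
  its \<open>i\<close>-th piece over \<open>\<sigma>\<close> is \<open>p \<mapsto> H (\<sigma> (s\<^sub>i p), t\<^sub>i p)\<close> with
  \<open>s\<^sub>i\<close> the \<open>i\<close>-th degeneracy and \<open>t\<^sub>i\<close> the map into \<open>J\<close> sending the vertices up to \<open>i\<close> to \<open>0\<close>
  and the later ones to \<open>1\<close>. All three theories have such continuous \<open>s\<^sub>i\<close> and \<open>t\<^sub>i\<close>, subject to the same
  identities with the face maps, so a single computation handles them.\<close>

section \<open>Continuity in closure spaces\<close>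

text \<open>Continuity is defined through closures but \<open>cs_prod\<close> through neighborhoods.
  The bridge: the complement of the preimage maps into \<open>pts Y - V\<close>, whose closure
  misses \<open>f x\<close>.\<close>

lemma cs_nbhd_vimage:
  assumes "closure_space Y" "cs_continuous X Y f" "x \<in> pts X" "cs_nbhd Y (f x) V"
  shows "cs_nbhd X x {p \<in> pts X. f p \<in> V}"
proof -
  let ?A = "pts X - {p \<in> pts X. f p \<in> V}"
  have "f ` ?A \<subseteq> pts Y - V"
    using assms(2) by (auto simp: cs_continuous_def)
  then have "cl Y (f ` ?A) \<subseteq> cl Y (pts Y - V)"
    by (intro closure_space_mono[OF assms(1)]) auto
  moreover have "f ` cl X ?A \<subseteq> cl Y (f ` ?A)"
    using assms(2) by (auto simp: cs_continuous_def)
  ultimately show ?thesis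
    using assms(3,4) by (auto simp: cs_nbhd_def cs_interior_def)
qed

lemma cs_continuous_compose:
  assumes "cs_continuous X Y f" "cs_continuous Y Z g"
  shows "cs_continuous X Z (g \<circ> f)"
  unfolding cs_continuous_def
proof (intro conjI allI impI)
  show "g \<circ> f \<in> pts X \<rightarrow> pts Z"
    using assms by (auto simp: cs_continuous_def)
next
  fix A assume "A \<subseteq> pts X"
  then have "f ` cl X A \<subseteq> cl Y (f ` A)" "f ` A \<subseteq> pts Y"
    using assms(1) by (auto simp: cs_continuous_def)
  moreover from this(2) have "g ` cl Y (f ` A) \<subseteq> cl Z (g ` f ` A)"
    using assms(2) by (simp add: cs_continuous_def)
  ultimately show "(g \<circ> f) ` cl X A \<subseteq> cl Z ((g \<circ> f) ` A)"
    unfolding image_comp[symmetric] by blast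
qed

text \<open>The universal property of the product: a box pulls back to the intersection of two
  neighborhoods of \<open>z\<close>, and this meets \<open>A\<close> whenever \<open>z\<close> lies
  in the closure of \<open>A\<close>.\<close>

lemma cs_continuous_Pair:
  assumes Z: "closure_space Z" and X: "closure_space X" and Y: "closure_space Y"
    and u: "cs_continuous Z X u" and v: "cs_continuous Z Y v"
  shows "cs_continuous Z (cs_prod X Y) (\<lambda>z. (u z, v z))"
  unfolding cs_continuous_def
proof (intro conjI allI impI)
  show "(\<lambda>z. (u z, v z)) \<in> pts Z \<rightarrow> pts (cs_prod X Y)"
    using u v by (auto simp: cs_continuous_def cs_prod_def)
next
  fix A assume A: "A \<subseteq> pts Z"
  have "(u z, v z) \<in> cl (cs_prod X Y) ((\<lambda>z. (u z, v z)) ` A)" if z: "z \<in> cl Z A" for z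
    unfolding in_cl_cs_prod
  proof (intro conjI allI impI)
    have zZ: "z \<in> pts Z"
      using z in_cl_iff_cs_nbhd[OF Z A] by blast
    show "u z \<in> pts X" "v z \<in> pts Y"
      using zZ u v by (auto simp: cs_continuous_def)
    fix U V assume "cs_nbhd X (u z) U" "cs_nbhd Y (v z) V"
    then have "cs_nbhd Z z ({p \<in> pts Z. u p \<in> U} \<inter> {p \<in> pts Z. v p \<in> V})"
      using cs_nbhd_vimage[OF X u zZ] cs_nbhd_vimage[OF Y v zZ] by (intro cs_nbhd_Int[OF Z])
    then have "({p \<in> pts Z. u p \<in> U} \<inter> {p \<in> pts Z. v p \<in> V}) \<inter> A \<noteq> {}"
      using z in_cl_iff_cs_nbhd[OF Z A] by blast
    then show "U \<times> V \<inter> (\<lambda>z. (u z, v z)) ` A \<noteq> {}"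
      by blast
  qed
  then show "(\<lambda>z. (u z, v z)) ` cl Z A \<subseteq> cl (cs_prod X Y) ((\<lambda>z. (u z, v z)) ` A)"
    by blast
qed

lemma cs_continuous_restrict:
  assumes "closure_space X" "cs_continuous X Y f"
  shows "cs_continuous X Y (restrict f (pts X))"
  unfolding cs_continuous_def
proof (intro conjI allI impI)
  show "restrict f (pts X) \<in> pts X \<rightarrow> pts Y"
    using assms(2) by (auto simp: cs_continuous_def)
next
  fix A assume A: "A \<subseteq> pts X"
  then have "cl X A \<subseteq> pts X"
    using assms(1) by (simp add: closure_space_def)
  then have "restrict f (pts X) ` cl X A = f ` cl X A" "restrict f (pts X) ` A = f ` A"
    using A by (auto intro!: image_cong)
  then show "restrict f (pts X) ` cl X A \<subseteq> cl Y (restrict f (pts X) ` A)"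
    using assms(2) A by (simp add: cs_continuous_def)
qed

lemma cs_continuous_cs_of_topology:
  assumes "continuous_map T U f"
  shows "cs_continuous (cs_of_topology T) (cs_of_topology U) f"
  using assms continuous_map_image_closure_subset[OF assms] continuous_map_image_subset_topspace[OF assms]
  by (auto simp: cs_continuous_def cs_of_topology_def)

lemma cs_continuous_cs_indiscrete:
  assumes "f \<in> pts X \<rightarrow> S" "closure_space X"
  shows "cs_continuous X (cs_indiscrete S) f"
  unfolding cs_continuous_def
proof (intro conjI allI impI)
  show "f \<in> pts X \<rightarrow> pts (cs_indiscrete S)"
    using assms(1) by (simp add: cs_indiscrete_def)
  show "f ` cl X A \<subseteq> cl (cs_indiscrete S) (f ` A)" if "A \<subseteq> pts X" for A
  proof (cases "A = {}")
    case True
    then show ?thesis using assms(2) by (simp add: closure_space_def)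
  next
    case False
    moreover have "cl X A \<subseteq> pts X"
      using that assms(2) by (simp add: closure_space_def)
    ultimately show ?thesis using assms(1) by (auto simp: cs_indiscrete_def)
  qed
qed

text \<open>Closures here are unions over points, so singletons suffice. When \<open>N i\<close> and
  \<open>N' i\<close> consist of the points from \<open>i\<close> upwards, the condition is
  monotonicity of \<open>f\<close>.\<close>

lemma cs_continuous_cs_of_singletons:
  assumes "f \<in> S \<rightarrow> S'" "\<And>i. i \<in> S \<Longrightarrow> f ` N i \<subseteq> N' (f i)"
  shows "cs_continuous (cs_of_singletons S N) (cs_of_singletons S' N') f"
  unfolding cs_continuous_def
proof (intro conjI allI impI)
  show "f \<in> pts (cs_of_singletons S N) \<rightarrow> pts (cs_of_singletons S' N')"
    using assms(1) by (simp add: cs_of_singletons_def)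
  show "f ` cl (cs_of_singletons S N) A \<subseteq> cl (cs_of_singletons S' N') (f ` A)"
    if "A \<subseteq> pts (cs_of_singletons S N)" for A
    using that assms(2) unfolding cs_of_singletons_def by simp blast
qed

section \<open>Chains\<close>

lemma cs_boundary_add: "cs_boundary S n (a + b) = cs_boundary S n a + cs_boundary S n b"
  by (simp add: cs_boundary_def frag_extend_add)

lemma cs_boundary_diff: "cs_boundary S n (a - b) = cs_boundary S n a - cs_boundary S n b"
  by (simp add: cs_boundary_def frag_extend_diff)

lemma cs_chain_map_add: "cs_chain_map S n f (a + b) = cs_chain_map S n f a + cs_chain_map S n f b"
  by (simp add: cs_chain_map_def frag_extend_add)

lemma cs_chain_map_diff: "cs_chain_map S n f (a - b) = cs_chain_map S n f a - cs_chain_map S n f b"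
  by (simp add: cs_chain_map_def frag_extend_diff)

lemma carrier_cs_chain_group:
  "c \<in> carrier (cs_chain_group S n X) \<longleftrightarrow> Poly_Mapping.keys c \<subseteq> cs_simplices S n X"
  by (simp add: cs_chain_group_def)

lemma cs_chain_map_in_carrier:
  assumes "closure_space (csimp S n)" "cs_continuous X Y f" "c \<in> carrier (cs_chain_group S n X)"
  shows "cs_chain_map S n f c \<in> carrier (cs_chain_group S n Y)"
proof -
  have "restrict (f \<circ> \<sigma>) (pts (csimp S n)) \<in> cs_simplices S n Y"
    if "\<sigma> \<in> cs_simplices S n X" for \<sigma>
    using that assms by (auto simp: cs_simplices_def intro!: cs_continuous_restrict cs_continuous_compose)
  then show ?thesis
    using assms(3) keys_frag_extend[of "\<lambda>\<sigma>. frag_of (restrict (f \<circ> \<sigma>) (pts (csimp S n)))" c]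
    by (fastforce simp: carrier_cs_chain_group cs_chain_map_def)
qed

text \<open>On a generator both sides agree face by face: the assumption puts the image of each face
  map inside the domain to which \<open>f \<circ> \<sigma>\<close> was restricted.\<close>

lemma cs_boundary_chain_map:
  assumes "\<And>i x. i \<le> Suc n \<Longrightarrow> x \<in> pts (csimp S n) \<Longrightarrow> cface S i x \<in> pts (csimp S (Suc n))"
  shows "cs_boundary S (Suc n) (cs_chain_map S (Suc n) f c) = cs_chain_map S n f (cs_boundary S (Suc n) c)"
proof (induction c rule: frag_induction[OF subset_UNIV, case_names zero one diff])
  case (one \<sigma>)
  have "restrict (restrict (f \<circ> \<sigma>) (pts (csimp S (Suc n))) \<circ> cface S i) (pts (csimp S n)) =
        restrict (f \<circ> restrict (\<sigma> \<circ> cface S i) (pts (csimp S n))) (pts (csimp S n))" if "i \<le> Suc n" for i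
    using assms[OF that] by (auto simp: restrict_def)
  then show ?case
    by (simp add: cs_boundary_def cs_chain_map_def frag_extend_sum frag_extend_cmul del: sum.atMost_Suc)
next
  case (diff a b)
  then show ?case by (simp add: cs_boundary_diff cs_chain_map_diff)
qed (auto simp: cs_boundary_def cs_chain_map_def)

section \<open>Boundaries, cycles and homology classes\<close>

lemma cs_boundaries_add:
  assumes "a \<in> cs_boundaries S n X" "b \<in> cs_boundaries S n X"
  shows "a + b \<in> cs_boundaries S n X"
proof -
  obtain c d where "a = cs_boundary S (Suc n) c" "c \<in> carrier (cs_chain_group S (Suc n) X)"
      "b = cs_boundary S (Suc n) d" "d \<in> carrier (cs_chain_group S (Suc n) X)"
    using assms by (auto simp: cs_boundaries_def)
  moreover have "c + d \<in> carrier (cs_chain_group S (Suc n) X)"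
    using calculation keys_add[of c d] by (auto simp: carrier_cs_chain_group)
  ultimately show ?thesis
    unfolding cs_boundaries_def by (metis cs_boundary_add imageI)
qed

lemma cs_boundaries_diff:
  assumes "a \<in> cs_boundaries S n X" "b \<in> cs_boundaries S n X"
  shows "a - b \<in> cs_boundaries S n X"
proof -
  obtain c d where "a = cs_boundary S (Suc n) c" "c \<in> carrier (cs_chain_group S (Suc n) X)"
      "b = cs_boundary S (Suc n) d" "d \<in> carrier (cs_chain_group S (Suc n) X)"
    using assms by (auto simp: cs_boundaries_def)
  moreover have "c - d \<in> carrier (cs_chain_group S (Suc n) X)"
    using calculation keys_diff[of c d] by (auto simp: carrier_cs_chain_group)
  ultimately show ?thesis
    unfolding cs_boundaries_def by (metis cs_boundary_diff imageI)
qed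

text \<open>Translation by the boundary \<open>a - b\<close> carries one coset to the other:
  \<open>e + a = (e + (a - b)) + b\<close>, and similarly backwards.\<close>

lemma cs_boundaries_coset_eq:
  assumes "a - b \<in> cs_boundaries S n X"
  shows "cs_boundaries S n X #>\<^bsub>cs_chain_group S n X\<^esub> a = cs_boundaries S n X #>\<^bsub>cs_chain_group S n X\<^esub> b"
proof -
  have "e + a \<in> (\<lambda>e. e + b) ` cs_boundaries S n X" if "e \<in> cs_boundaries S n X" for e
    using cs_boundaries_add[OF that assms] by (intro image_eqI[of _ _ "e + (a - b)"]) auto
  moreover have "e + b \<in> (\<lambda>e. e + a) ` cs_boundaries S n X" if "e \<in> cs_boundaries S n X" for e
    using cs_boundaries_diff[OF that assms] by (intro image_eqI[of _ _ "e - (a - b)"]) auto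
  ultimately show ?thesis
    by (auto simp: r_coset_def cs_chain_group_def image_iff)
qed

text \<open>Needed so that the carrier of \<open>subgroup_generated\<close> in the homology group is
  the set of cycles itself.\<close>

lemma subgroup_cs_cycles: "subgroup (cs_cycles S n X) (cs_chain_group S n X)"
proof -
  interpret G: group "cs_chain_group S n X"
    by (simp add: cs_chain_group_def)
  show ?thesis
  proof (rule G.subgroupI)
    show "cs_cycles S n X \<subseteq> carrier (cs_chain_group S n X)"
      by (auto simp: cs_cycles_def)
    have "0 \<in> cs_cycles S n X"
      by (simp add: cs_cycles_def carrier_cs_chain_group cs_boundary_def)
    then show "cs_cycles S n X \<noteq> {}" by blast
    show "inv\<^bsub>cs_chain_group S n X\<^esub> a \<in> cs_cycles S n X" if "a \<in> cs_cycles S n X" for a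
      using that by (simp add: cs_cycles_def cs_chain_group_def cs_boundary_def frag_extend_minus
            split: if_splits)
    show "a \<otimes>\<^bsub>cs_chain_group S n X\<^esub> b \<in> cs_cycles S n X"
      if "a \<in> cs_cycles S n X" "b \<in> cs_cycles S n X" for a b
      using that keys_add[of a b]
      by (auto simp: cs_cycles_def cs_chain_group_def cs_boundary_add)
  qed
qed

text \<open>The boundary part stays separate because the two parts are treated differently later:
  \<open>z\<close> by the prism identity, \<open>b\<close> by the chain map property.\<close>

lemma cs_homology_class_cases:
  assumes "a \<in> carrier (cs_homology_group S n X)" "c \<in> a"
  obtains b z where "b \<in> cs_boundaries S n X" "z \<in> cs_cycles S n X" "c = b + z"
proof -
  have "carrier (subgroup_generated (cs_chain_group S n X) (cs_cycles S n X)) = cs_cycles S n X"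
    by (rule subgroup.carrier_subgroup_generated_subgroup[OF subgroup_cs_cycles])
  moreover have "mult (subgroup_generated (cs_chain_group S n X) (cs_cycles S n X)) = (+)"
    by (auto simp: fun_eq_iff cs_chain_group_def)
  ultimately show ?thesis
    using assms that
    by (auto simp: cs_homology_group_def FactGroup_def RCOSETS_def r_coset_def)
qed

section \<open>The prism operator\<close>

text \<open>The cancellation behind the prism identity. Read \<open>F l i\<close> as the
  \<open>l\<close>-th face of the \<open>i\<close>-th prism piece, \<open>G l i\<close> as the
  \<open>i\<close>-th piece over the \<open>l\<close>-th face, and \<open>E i\<close>,
  \<open>E (Suc i)\<close> as the two walls of the \<open>i\<close>-th piece. The walls telescope;
  the other faces cancel against the \<open>G\<close> terms, because each index shift reverses the
  sign.\<close>

lemma sum_prism: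
  fixes F G :: "nat \<Rightarrow> nat \<Rightarrow> 'a \<Rightarrow>\<^sub>0 int" and E :: "nat \<Rightarrow> 'a \<Rightarrow>\<^sub>0 int"
  assumes low: "\<And>l i. l \<le> i \<Longrightarrow> i < n \<Longrightarrow> F l (Suc i) = G l i"
    and diag: "\<And>i. i \<le> n \<Longrightarrow> F i i = E i" "\<And>i. i \<le> n \<Longrightarrow> F (Suc i) i = E (Suc i)"
    and high: "\<And>l i. i < l \<Longrightarrow> l \<le> n \<Longrightarrow> F (Suc l) i = G l i"
  shows "(\<Sum>i\<le>n. \<Sum>l\<le>Suc n. frag_cmul ((-1) ^ (i + l)) (F l i)) +
         (\<Sum>l\<le>n. \<Sum>i<n. frag_cmul ((-1) ^ (l + i)) (G l i)) = E 0 - E (Suc n)"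
proof -
  let ?c = "\<lambda>k x. frag_cmul ((-1) ^ k) x :: 'a \<Rightarrow>\<^sub>0 int"
  let ?A = "\<lambda>i. \<Sum>l<i. ?c (i + l) (F l i)"
  let ?B = "\<lambda>i. \<Sum>l\<in>{Suc i..n}. ?c (i + l) (G l i)"
  have "(\<Sum>l\<le>Suc n. ?c (i + l) (F l i)) = ?A i + (E i - E (Suc i)) - ?B i" if "i \<le> n" for i
  proof -
    \<comment> \<open>The faces \<open>i\<close> and \<open>Suc i\<close> are the walls, with signs
      plus and minus; they separate the two ranges covered by \<open>low\<close> and
      \<open>high\<close>.\<close>
    have "{..Suc n} = {..<i} \<union> {i, Suc i} \<union> {Suc (Suc i)..Suc n}"
      using that by auto
    then have "(\<Sum>l\<le>Suc n. ?c (i + l) (F l i)) =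
        ?A i + (\<Sum>l\<in>{i, Suc i}. ?c (i + l) (F l i)) + (\<Sum>l\<in>{Suc (Suc i)..Suc n}. ?c (i + l) (F l i))"
      by (simp only:) (subst sum.union_disjoint; auto)+
    moreover have "(\<Sum>l\<in>{i, Suc i}. ?c (i + l) (F l i)) = E i - E (Suc i)"
      using diag[OF that] by (simp flip: mult_2)
    moreover have "(\<Sum>l\<in>{Suc (Suc i)..Suc n}. ?c (i + l) (F l i)) = - ?B i"
      using high by (simp add: sum.shift_bounds_cl_Suc_ivl flip: sum_negf del: sum.cl_ivl_Suc)
    ultimately show ?thesis by simp
  qed
  then have "(\<Sum>i\<le>n. \<Sum>l\<le>Suc n. ?c (i + l) (F l i)) =
      (\<Sum>i\<le>n. ?A i) + (\<Sum>i\<le>n. E i - E (Suc i)) - (\<Sum>i\<le>n. ?B i)"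
    by (simp add: sum.distrib sum_subtractf)
  also have "(\<Sum>i\<le>n. E i - E (Suc i)) = E 0 - E (Suc n)"
    by (rule sum_telescope)
  \<comment> \<open>\<open>?A 0\<close> is empty, so the outer index can be shifted by one before
    \<open>low\<close> applies; likewise \<open>?B n\<close> is empty below.\<close>
  also have "(\<Sum>i\<le>n. ?A i) = (\<Sum>i<n. \<Sum>l\<le>i. - ?c (i + l) (G l i))"
    unfolding lessThan_Suc_atMost[symmetric, of n] sum.lessThan_Suc_shift[of ?A n]
    using low by (simp add: lessThan_Suc_atMost del: sum.lessThan_Suc)
  also have "(\<Sum>i\<le>n. ?B i) = (\<Sum>i<n. ?B i)"
    unfolding lessThan_Suc_atMost[symmetric, of n] by simp
  finally have eq: "(\<Sum>i\<le>n. \<Sum>l\<le>Suc n. ?c (i + l) (F l i)) =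
      E 0 - E (Suc n) - (\<Sum>i<n. (\<Sum>l\<le>i. ?c (i + l) (G l i)) + ?B i)"
    by (simp add: sum.distrib flip: sum_negf del: sum.atMost_Suc)
  \<comment> \<open>The triangles \<open>l \<le> i\<close> and \<open>i < l\<close> together fill
    the index rectangle of the \<open>G\<close> sum.\<close>
  have "(\<Sum>l\<le>i. ?c (i + l) (G l i)) + ?B i = (\<Sum>l\<le>n. ?c (l + i) (G l i))" if "i < n" for i
  proof -
    have "{..n} = {..i} \<union> {Suc i..n}"
      using that by auto
    then show ?thesis
      by (simp only: add.commute[of i]) (subst sum.union_disjoint; auto)
  qed
  then show ?thesis
    unfolding eq by (subst sum.swap) simp
qed

text \<open>\<open>height k\<close> sends the vertices below \<open>k\<close> to \<open>0\<close> and the others to \<open>1\<close>, so the map \<open>t\<^sub>i\<close> above is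
  \<open>height (Suc i)\<close>; the shift lets \<open>height 0\<close> and \<open>height (Suc n)\<close> describe the two ends of the prism.\<close>

locale prism_simplices =
  fixes S :: "'p simplices" and J :: "'j::zero_neq_one cspace"
    and degen :: "nat \<Rightarrow> 'p \<Rightarrow> 'p" and height :: "nat \<Rightarrow> 'p \<Rightarrow> 'j"
  assumes closure_csimp: "closure_space (csimp S n)"
    and closure_J: "closure_space J"
    and face: "i \<le> Suc n \<Longrightarrow> x \<in> pts (csimp S n) \<Longrightarrow> cface S i x \<in> pts (csimp S (Suc n))"
    and continuous_degen: "i \<le> n \<Longrightarrow> cs_continuous (csimp S (Suc n)) (csimp S n) (degen i)"
    and continuous_height: "k \<le> Suc n \<Longrightarrow> cs_continuous (csimp S n) J (height k)"
    and degen_face_le: "i \<le> k \<Longrightarrow> degen (Suc k) (cface S i x) = cface S i (degen k x)"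
    and degen_face: "degen k (cface S k x) = x"
    and degen_face_Suc: "degen k (cface S (Suc k) x) = x"
    and degen_face_gt: "k < i \<Longrightarrow> degen k (cface S (Suc i) x) = cface S i (degen k x)"
    and height_face_le: "i \<le> k \<Longrightarrow> height (Suc k) (cface S i x) = height k x"
    and height_face_ge: "k \<le> i \<Longrightarrow> height k (cface S i x) = height k x"
    and height_0: "height 0 x = 1"
    and height_Suc: "x \<in> pts (csimp S n) \<Longrightarrow> height (Suc n) x = 0"
begin

definition prism_simplex :: "('a \<times> 'j \<Rightarrow> 'b) \<Rightarrow> nat \<Rightarrow> nat \<Rightarrow> ('p \<Rightarrow> 'a) \<Rightarrow> 'p \<Rightarrow> 'b" where
  "prism_simplex H n i \<sigma> = restrict (\<lambda>p. H (\<sigma> (degen i p), height (Suc i) p)) (pts (csimp S (Suc n)))"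

definition prism :: "('a \<times> 'j \<Rightarrow> 'b) \<Rightarrow> nat \<Rightarrow> (('p \<Rightarrow> 'a) \<Rightarrow>\<^sub>0 int) \<Rightarrow> (('p \<Rightarrow> 'b) \<Rightarrow>\<^sub>0 int)" where
  "prism H n = frag_extend (\<lambda>\<sigma>. \<Sum>i\<le>n. frag_cmul ((-1) ^ i) (frag_of (prism_simplex H n i \<sigma>)))"

lemma degen_in: "i \<le> n \<Longrightarrow> x \<in> pts (csimp S (Suc n)) \<Longrightarrow> degen i x \<in> pts (csimp S n)"
  using continuous_degen by (auto simp: cs_continuous_def)

text \<open>Each piece is \<open>H\<close> after a pair of continuous maps, so the universal
  property of \<open>cs_prod\<close> gives continuity.\<close>

lemma prism_simplex_in_cs_simplices:
  assumes "closure_space X" "cs_continuous (cs_prod X J) Y H" "\<sigma> \<in> cs_simplices S n X" "i \<le> n"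
  shows "prism_simplex H n i \<sigma> \<in> cs_simplices S (Suc n) Y"
proof -
  have "cs_continuous (csimp S (Suc n)) X (\<lambda>p. \<sigma> (degen i p))"
    using assms cs_continuous_compose[OF continuous_degen] by (fastforce simp: cs_simplices_def comp_def)
  then have "cs_continuous (csimp S (Suc n)) (cs_prod X J) (\<lambda>p. (\<sigma> (degen i p), height (Suc i) p))"
    using assms by (intro cs_continuous_Pair closure_csimp closure_J continuous_height) auto
  from cs_continuous_restrict[OF closure_csimp cs_continuous_compose[OF this assms(2)]]
  show ?thesis
    by (simp add: cs_simplices_def prism_simplex_def comp_def)
qed

lemma prism_in_carrier:
  assumes "closure_space X" "cs_continuous (cs_prod X J) Y H" "c \<in> carrier (cs_chain_group S n X)"
  shows "prism H n c \<in> carrier (cs_chain_group S (Suc n) Y)"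
proof -
  have "Poly_Mapping.keys (\<Sum>i\<le>n. frag_cmul ((-1) ^ i) (frag_of (prism_simplex H n i \<sigma>)))
      \<subseteq> cs_simplices S (Suc n) Y" if "\<sigma> \<in> cs_simplices S n X" for \<sigma>
    using prism_simplex_in_cs_simplices[OF assms(1,2) that]
    by (intro order_trans[OF keys_sum]) (auto dest!: keys_cmul[THEN subsetD])
  then show ?thesis
    using assms(3) unfolding carrier_cs_chain_group prism_def
    by (intro order_trans[OF keys_frag_extend]) blast
qed

lemma cs_boundary_prism_of:
  assumes H: "\<And>x. x \<in> pts X \<Longrightarrow> H (x, 0) = f x \<and> H (x, 1) = g x"
    and \<sigma>: "\<sigma> \<in> cs_simplices S n X"
  shows "cs_boundary S (Suc n) (prism H n (frag_of \<sigma>)) + prism H (n - 1) (cs_boundary S n (frag_of \<sigma>)) =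
         cs_chain_map S n g (frag_of \<sigma>) - cs_chain_map S n f (frag_of \<sigma>)"
proof -
  let ?D = "pts (csimp S n)"
  define F where "F l i = frag_of (restrict (prism_simplex H n i \<sigma> \<circ> cface S l) ?D)" for l i
  define G where "G l i = frag_of (prism_simplex H (n - 1) i
      (restrict (\<sigma> \<circ> cface S l) (pts (csimp S (n - 1)))))" for l i
  \<comment> \<open>For \<open>k\<close> from 1 to \<open>n\<close> this is the wall shared by the
    pieces \<open>k - 1\<close> and \<open>k\<close>; \<open>E 0\<close> and
    \<open>E (Suc n)\<close> are the ends of the prism.\<close>
  define E where "E k = frag_of (restrict (\<lambda>p. H (\<sigma> p, height k p)) ?D)" for k
  have F: "F l i = frag_of (restrict (\<lambda>p. H (\<sigma> (degen i (cface S l p)), height (Suc i) (cface S l p))) ?D)"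
    if "l \<le> Suc n" for l i
    unfolding F_def prism_simplex_def using face[OF that]
    by (intro arg_cong[of _ _ frag_of] restrict_ext) simp
  \<comment> \<open>The bound \<open>i < n\<close> makes \<open>Suc (n - 1)\<close> equal to
    \<open>n\<close> and puts \<open>degen i p\<close> in the \<open>(n - 1)\<close>-simplex, so the
    inner restriction disappears.\<close>
  have G: "G l i = frag_of (restrict (\<lambda>p. H (\<sigma> (cface S l (degen i p)), height (Suc i) p)) ?D)"
    if "i < n" for l i
    unfolding G_def prism_simplex_def using degen_in[of i "n - 1"] that
    by (intro arg_cong[of _ _ frag_of] restrict_ext) auto
  have "(\<Sum>i\<le>n. \<Sum>l\<le>Suc n. frag_cmul ((-1) ^ (i + l)) (F l i)) +
        (\<Sum>l\<le>n. \<Sum>i<n. frag_cmul ((-1) ^ (l + i)) (G l i)) = E 0 - E (Suc n)"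
  \<comment> \<open>Face \<open>i\<close> lowers the index of \<open>height (Suc i)\<close> to
    \<open>i\<close> while face \<open>Suc i\<close> keeps it; hence the walls \<open>E i\<close>
    and \<open>E (Suc i)\<close>.\<close>
  proof (rule sum_prism)
    show "F l (Suc i) = G l i" if "l \<le> i" "i < n" for l i
      using that by (simp add: F G degen_face_le height_face_le)
    show "F i i = E i" if "i \<le> n" for i
      using that by (simp add: F E_def degen_face height_face_le)
    show "F (Suc i) i = E (Suc i)" if "i \<le> n" for i
      using that by (simp add: F E_def degen_face_Suc height_face_ge)
    show "F (Suc l) i = G l i" if "i < l" "l \<le> n" for l i
      using that by (simp add: F G degen_face_gt height_face_ge)
  qed
  moreover have "cs_boundary S (Suc n) (prism H n (frag_of \<sigma>)) =
      (\<Sum>i\<le>n. \<Sum>l\<le>Suc n. frag_cmul ((-1) ^ (i + l)) (F l i))"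
    by (simp add: cs_boundary_def prism_def frag_extend_sum frag_extend_cmul frag_cmul_sum F_def
        power_add comp_def del: sum.atMost_Suc)
  moreover have "prism H (n - 1) (cs_boundary S n (frag_of \<sigma>)) =
      (\<Sum>l\<le>n. \<Sum>i<n. frag_cmul ((-1) ^ (l + i)) (G l i))"
  proof (cases n)
    \<comment> \<open>The truncated \<open>n - 1\<close> is harmless: the boundary in degree 0 is
      zero and the sum over \<open>i < 0\<close> is empty.\<close>
    case 0
    then show ?thesis by (simp add: cs_boundary_def prism_def)
  next
    case (Suc m)
    then show ?thesis
      by (simp add: cs_boundary_def prism_def frag_extend_sum frag_extend_cmul frag_cmul_sum G_def
          power_add comp_def lessThan_Suc_atMost del: sum.atMost_Suc sum.lessThan_Suc)
  qed
  moreover have "\<sigma> p \<in> pts X" if "p \<in> ?D" for p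
    using \<sigma> that by (auto simp: cs_simplices_def cs_continuous_def)
  then have "E 0 = cs_chain_map S n g (frag_of \<sigma>)" "E (Suc n) = cs_chain_map S n f (frag_of \<sigma>)"
    unfolding E_def cs_chain_map_def frag_extend_of
    by (auto intro!: arg_cong[of _ _ frag_of] restrict_ext simp: height_0 height_Suc H)
  ultimately show ?thesis by simp
qed

lemma cs_boundary_prism:
  assumes H: "\<And>x. x \<in> pts X \<Longrightarrow> H (x, 0) = f x \<and> H (x, 1) = g x"
    and c: "c \<in> carrier (cs_chain_group S n X)"
  shows "cs_boundary S (Suc n) (prism H n c) + prism H (n - 1) (cs_boundary S n c) =
         cs_chain_map S n g c - cs_chain_map S n f c"
  \<comment> \<open>The induction ranges over singular simplices of \<open>X\<close> only, since
    \<open>H\<close> is compared with \<open>f\<close> and \<open>g\<close> just on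
    \<open>pts X\<close>.\<close>
  using c unfolding carrier_cs_chain_group
proof (induction c rule: frag_induction)
  case zero
  then show ?case by (simp add: cs_boundary_def prism_def cs_chain_map_def)
next
  case (one \<sigma>)
  then show ?case using cs_boundary_prism_of[OF H] by simp
next
  case (diff a b)
  have "cs_boundary S (Suc n) (prism H n (a - b)) + prism H (n - 1) (cs_boundary S n (a - b)) =
      (cs_boundary S (Suc n) (prism H n a) + prism H (n - 1) (cs_boundary S n a)) -
      (cs_boundary S (Suc n) (prism H n b) + prism H (n - 1) (cs_boundary S n b))"
    by (simp add: prism_def frag_extend_diff cs_boundary_diff)
  then show ?case
    unfolding diff by (simp add: cs_chain_map_diff)
qed

section \<open>Homotopy invariance of the induced maps\<close>

lemma one_step_homotopic_hom_induced_eq: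
  assumes X: "closure_space X" and fg: "one_step_homotopic J X Y f g"
  shows "cs_hom_induced S n X Y f = cs_hom_induced S n X Y g"
proof -
  obtain H where H: "cs_continuous (cs_prod X J) Y H" "\<And>x. x \<in> pts X \<Longrightarrow> H (x, 0) = f x \<and> H (x, 1) = g x"
    and f: "cs_continuous X Y f" and g: "cs_continuous X Y g"
    using fg by (auto simp: one_step_homotopic_def)
  have bd: "cs_chain_map S n h b \<in> cs_boundaries S n Y"
    if "cs_continuous X Y h" "b \<in> cs_boundaries S n X" for h b
    using that cs_chain_map_in_carrier[OF closure_csimp that(1)] cs_boundary_chain_map[OF face, of n h]
    by (fastforce simp: cs_boundaries_def simp flip: cs_boundary_chain_map[OF face])
  have "cs_chain_map S n f c - cs_chain_map S n g c \<in> cs_boundaries S n Y"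
    if a: "a \<in> carrier (cs_homology_group S n X)" "c \<in> a" for a c
  proof -
    obtain b z where b: "b \<in> cs_boundaries S n X" and z: "z \<in> cs_cycles S n X" and c: "c = b + z"
      using cs_homology_class_cases[OF a] .
    have z': "z \<in> carrier (cs_chain_group S n X)" "cs_boundary S n z = 0"
      using z by (auto simp: cs_cycles_def)
    \<comment> \<open>Since \<open>z\<close> is a cycle, the prism of its boundary vanishes.\<close>
    then have "cs_chain_map S n g z - cs_chain_map S n f z = cs_boundary S (Suc n) (prism H n z)"
      using cs_boundary_prism[where f = f and g = g, OF H(2) z'(1)] by (simp add: prism_def)
    also have "\<dots> \<in> cs_boundaries S n Y"
      using prism_in_carrier[OF X H(1) z'(1)] by (simp add: cs_boundaries_def)
    finally have "(cs_chain_map S n f b - cs_chain_map S n g b) -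
        (cs_chain_map S n g z - cs_chain_map S n f z) \<in> cs_boundaries S n Y"
      using bd[OF f b] bd[OF g b] by (metis cs_boundaries_diff)
    then show ?thesis
      by (simp add: c cs_chain_map_add algebra_simps)
  qed
  \<comment> \<open>The induced maps are unions over representatives \<open>c\<close>, so it
    suffices that the cosets agree for each \<open>c\<close>.\<close>
  then show ?thesis
    unfolding cs_hom_induced_def
    by (intro restrict_ext SUP_cong refl cs_boundaries_coset_eq)
qed

text \<open>Equality of induced maps is symmetric and transitive, so it spreads along finite zigzags
  of one-step homotopies.\<close>

lemma cs_homotopic_hom_induced_eq:
  assumes X: "closure_space X" and "cs_homotopic J X Y f g"
  shows "cs_hom_induced S n X Y f = cs_hom_induced S n X Y g"
  using assms(2) unfolding cs_homotopic_def
  by (induction rule: equivclp_induct) (metis one_step_homotopic_hom_induced_eq[OF X])+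

end

section \<open>The three families of simplices\<close>

text \<open>The affine map collapsing the vertices \<open>k\<close> and \<open>Suc k\<close>, in
  barycentric coordinates: their weights are added.\<close>

definition simplicial_degen :: "nat \<Rightarrow> (nat \<Rightarrow> real) \<Rightarrow> nat \<Rightarrow> real" where
  "simplicial_degen k x = (\<lambda>i. if i < k then x i else if i = k then x k + x (Suc k) else x (Suc i))"

text \<open>On a simplex this is the sum of the barycentric coordinates from \<open>k\<close> on; written as a difference
  it does not refer to the dimension.\<close>

definition simplicial_height :: "nat \<Rightarrow> (nat \<Rightarrow> real) \<Rightarrow> real" where
  "simplicial_height k x = 1 - (\<Sum>j<k. x j)"

definition vertex_degen :: "nat \<Rightarrow> nat \<Rightarrow> nat" where
  "vertex_degen k j = (if j \<le> k then j else j - 1)"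

definition vertex_height :: "nat \<Rightarrow> nat \<Rightarrow> nat" where
  "vertex_height k j = (if k \<le> j then 1 else 0)"

text \<open>The induction starts at \<open>n = k\<close>, where coordinate \<open>k\<close> has just
  absorbed \<open>x (Suc k)\<close>; each later coordinate is merely shifted.\<close>

lemma sum_simplicial_degen:
  assumes "k \<le> n"
  shows "(\<Sum>i\<le>n. simplicial_degen k x i) = (\<Sum>i\<le>Suc n. x i)"
  using assms
proof (induction n rule: dec_induct)
  case base
  have "(\<Sum>i<k. simplicial_degen k x i) = (\<Sum>i<k. x i)"
    by (rule sum.cong) (auto simp: simplicial_degen_def)
  then show ?case
    by (simp add: simplicial_degen_def flip: lessThan_Suc_atMost)
next
  case (step m)
  then show ?case by (simp add: simplicial_degen_def)
qed

lemma simplicial_degen_in_standard_simplex: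
  assumes "k \<le> n" "x \<in> standard_simplex (Suc n)"
  shows "simplicial_degen k x \<in> standard_simplex n"
proof -
  have x: "\<And>i. 0 \<le> x i" "\<And>i. i > Suc n \<Longrightarrow> x i = 0" "(\<Sum>i\<le>Suc n. x i) = 1"
    using assms(2) by (auto simp: standard_simplex_def)
  have s: "(\<Sum>i\<le>n. simplicial_degen k x i) = 1"
    using sum_simplicial_degen[OF assms(1)] x(3) by simp
  have nn: "0 \<le> simplicial_degen k x i" for i
    using x(1) by (simp add: simplicial_degen_def)
  have z: "simplicial_degen k x i = 0" if "i > n" for i
    using that assms(1) x(2) by (simp add: simplicial_degen_def)
  \<comment> \<open>\<open>standard_simplex\<close> also bounds coordinates by 1; a coordinate is at
    most the sum of all the nonnegative coordinates.\<close>
  have "simplicial_degen k x i \<le> 1" for i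
  proof (cases "i \<le> n")
    case True
    then show ?thesis
      using member_le_sum[of i "{..n}" "simplicial_degen k x"] nn s by simp
  qed (simp add: z)
  with nn z s show ?thesis by (auto simp: standard_simplex_def)
qed

lemma continuous_map_simplicial_degen:
  assumes "k \<le> n"
  shows "continuous_map (subtopology (powertop_real UNIV) (standard_simplex (Suc n)))
           (subtopology (powertop_real UNIV) (standard_simplex n)) (simplicial_degen k)"
proof -
  have "continuous_map (powertop_real UNIV) euclideanreal (\<lambda>x. simplicial_degen k x i)" for i
    unfolding simplicial_degen_def
    by (auto intro!: continuous_map_add continuous_map_product_projection)
  then show ?thesis
    using simplicial_degen_in_standard_simplex[OF assms]
    by (auto simp: continuous_map_in_subtopology continuous_map_componentwise_UNIV
        intro: continuous_map_from_subtopology)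
qed

lemma simplicial_height_range:
  assumes "x \<in> standard_simplex n" "k \<le> Suc n"
  shows "simplicial_height k x \<in> {0..1}"
proof -
  have "(\<Sum>j<k. x j) \<le> (\<Sum>j\<le>n. x j)"
    using assms by (intro sum_mono2) (auto simp: standard_simplex_def)
  moreover have "0 \<le> (\<Sum>j<k. x j)"
    using assms(1) by (auto simp: standard_simplex_def intro!: sum_nonneg)
  ultimately show ?thesis
    using assms(1) by (simp add: standard_simplex_def simplicial_height_def)
qed

lemma continuous_map_simplicial_height:
  assumes "k \<le> Suc n"
  shows "continuous_map (subtopology (powertop_real UNIV) (standard_simplex n))
           (top_of_set {0..1}) (simplicial_height k)"
proof -
  have "continuous_map (powertop_real UNIV) euclideanreal (simplicial_height k)"
    unfolding simplicial_height_def
    by (intro continuous_map_diff continuous_map_sum continuous_map_product_projection) auto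
  then show ?thesis
    using simplicial_height_range[OF _ assms]
    by (auto simp: continuous_map_in_subtopology intro: continuous_map_from_subtopology)
qed

text \<open>\<open>simplical_face i\<close> inserts a zero at position \<open>i\<close>. Partial
  sums ending at or before it are unchanged; the next lemma treats those that run past it. Together
  they give the height identities.\<close>

lemma sum_simplical_face_ge: "k \<le> i \<Longrightarrow> (\<Sum>j<k. simplical_face i x j) = (\<Sum>j<k. x j)"
  by (rule sum.cong) (auto simp: simplical_face_def)

lemma sum_simplical_face_le:
  assumes "i \<le> k"
  shows "(\<Sum>j<Suc k. simplical_face i x j) = (\<Sum>j<k. x j)"
  using assms
proof (induction k rule: dec_induct)
  case base
  then show ?case
    using sum_simplical_face_ge[of i i x] by (simp add: simplical_face_def)
next
  case (step m)
  then show ?case by (simp add: simplical_face_def)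
qed

section \<open>Verification of the prism identities for the three families\<close>

lemma prism_simplices_I: "prism_simplices S_I J_I simplicial_degen simplicial_height"
proof
  show "closure_space (csimp S_I n)" for n
    by (simp add: S_I_def closure_space_cs_of_topology)
  show "closure_space J_I"
    by (simp add: J_I_def closure_space_cs_of_topology)
  show "cface S_I i x \<in> pts (csimp S_I (Suc n))" if "i \<le> Suc n" "x \<in> pts (csimp S_I n)" for i n x
    using that simplical_face_in_standard_simplex[of "Suc n" i x]
    by (simp add: S_I_def cs_of_topology_def)
  show "cs_continuous (csimp S_I (Suc n)) (csimp S_I n) (simplicial_degen i)" if "i \<le> n" for i n
    using continuous_map_simplicial_degen[OF that] by (simp add: S_I_def cs_continuous_cs_of_topology)
  show "cs_continuous (csimp S_I n) J_I (simplicial_height k)" if "k \<le> Suc n" for k n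
    using continuous_map_simplicial_height[OF that]
    by (simp add: S_I_def J_I_def cs_continuous_cs_of_topology)
  show "simplicial_height (Suc n) x = 0" if "x \<in> pts (csimp S_I n)" for n x
    using that
    by (simp add: S_I_def cs_of_topology_def standard_simplex_def simplicial_height_def lessThan_Suc_atMost
        del: sum.lessThan_Suc)
\<comment> \<open>The remaining identities hold coordinatewise. The partial-sum lemmas enter with
  \<open>simplical_face\<close> unfolded, because it is unfolded in the goals too.\<close>
qed (auto simp: S_I_def simplicial_degen_def simplicial_height_def simplical_face_def[abs_def] fun_eq_iff
    sum_simplical_face_ge[unfolded simplical_face_def]
    sum_simplical_face_le[unfolded simplical_face_def] simp del: sum.lessThan_Suc)

lemma prism_simplices_one: "prism_simplices S_one J_one vertex_degen vertex_height"
proof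
  have S: "closure_space (csimp S_one n)" for n
    by (simp add: S_one_def closure_space_cs_indiscrete)
  then show "closure_space (csimp S_one n)" for n .
  show "closure_space J_one"
    by (simp add: J_one_def closure_space_cs_indiscrete)
  show "cs_continuous (csimp S_one (Suc n)) (csimp S_one n) (vertex_degen i)" if "i \<le> n" for i n
    using that S[of "Suc n"]
    \<comment> \<open>Only the domain \<open>{0..Suc n}\<close> is unfolded; the codomain must keep
      its form for the continuity rule.\<close>
    by (auto simp: S_one_def cs_indiscrete_def[of "{0..Suc n}"] vertex_degen_def
        intro!: cs_continuous_cs_indiscrete)
  show "cs_continuous (csimp S_one n) J_one (vertex_height k)" for k n
    unfolding J_one_def using S[of n]
    by (intro cs_continuous_cs_indiscrete) (auto simp: vertex_height_def)
qed (auto simp: S_one_def cs_indiscrete_def vertex_face_def vertex_degen_def vertex_height_def)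

text \<open>Point closures are upward sets in the simplices and in \<open>J_plus\<close>, so
  continuity holds because \<open>vertex_degen\<close> and \<open>vertex_height\<close> are
  monotone.\<close>

lemma prism_simplices_plus: "prism_simplices S_plus J_plus vertex_degen vertex_height"
proof
  show "closure_space (csimp S_plus n)" for n
    by (auto simp: S_plus_def intro!: closure_space_cs_of_singletons)
  show "closure_space J_plus"
    unfolding J_plus_def by (rule closure_space_cs_of_singletons) auto
  show "cs_continuous (csimp S_plus (Suc n)) (csimp S_plus n) (vertex_degen i)" if "i \<le> n" for i n
    using that by (auto simp: S_plus_def vertex_degen_def intro!: cs_continuous_cs_of_singletons)
  show "cs_continuous (csimp S_plus n) J_plus (vertex_height k)" for k n
    unfolding J_plus_def
    by (auto simp: S_plus_def vertex_height_def split: if_splits intro!: cs_continuous_cs_of_singletons)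
qed (auto simp: S_plus_def cs_of_singletons_def vertex_face_def vertex_degen_def vertex_height_def)

theorem theorem4p24:
  fixes X :: "'a cspace" and Y :: "'b cspace" and f g :: "'a \<Rightarrow> 'b"
  assumes "closure_space X" and "closure_space Y"
    and "cs_continuous X Y f" and "cs_continuous X Y g"
  shows "(cs_homotopic J_I X Y f g \<longrightarrow>
            (\<forall>n. cs_hom_induced S_I n X Y f = cs_hom_induced S_I n X Y g)) \<and>
         (cs_homotopic J_one X Y f g \<longrightarrow>
            (\<forall>n. cs_hom_induced S_one n X Y f = cs_hom_induced S_one n X Y g)) \<and>
         (cs_homotopic J_plus X Y f g \<longrightarrow>
            (\<forall>n. cs_hom_induced S_plus n X Y f = cs_hom_induced S_plus n X Y g))"
  using prism_simplices.cs_homotopic_hom_induced_eq[OF prism_simplices_I assms(1)]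
    prism_simplices.cs_homotopic_hom_induced_eq[OF prism_simplices_one assms(1)]
    prism_simplices.cs_homotopic_hom_induced_eq[OF prism_simplices_plus assms(1)]
  by blast

end
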